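(* Let $(C,e,\lambda,\oplus)$ be a Catalan structure and let $h\colon C\to C$ be the map defined in the context. The fixed points of $h$ are exactly $e$ and the elements $$u\oplus\lambda(h(u))\quad\text{for }u\in C.$$ In particular, for every $k\ge 0$ there are $|C_k|$ fixed points of size $2k+1$ (where $|C_k|$ is the $k$-th Catalan number), and there are no fixed points of positive even size.
   Context: A Catalan structure is a quadruple $(C,e,\lambda,\oplus)$ where $C=\bigsqcup_{n\ge 0}C_n$ with $C_0=\{e\}$ (elements of $C_n$ have size $n$), $\lambda\colon C_n\to C_{n+1}$, $\oplus\colon C_m\times C_n\to C_{m+n}$, $\oplus$ is associative with two-sided identity $e$, and every $t\in C$ can be written uniquely in exactly one of three forms: $t=e$; $t=\lambda(s)$ with $s\in C$ (indecomposable); $t=u\oplus v$ with $u$ indecomposable and $v\in C\setminus C_0$ (decomposable). Hence every nonempty $t$ is uniquely $\lambda(u)\oplus v$ ($v=e$ allowed). Put $\gamma(t)=t\oplus\lambda(e)$ and define $\ominus$ by $e\ominus v=v$, $\lambda(u)\ominus v=\lambda(u\ominus v)$, $(t\oplus u)\ominus v=t\oplus(u\ominus v)$ for $t,u\ne e$ (well defined; one may take $t$ indecomposable). The map $h$ is defined by $h(e)=e$ and $h(\lambda(u)\oplus v)=h(v)\ominus\gamma(h(u))$. *)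

theory Defs
  imports Complex_Main
begin

text \<open>\<open>C n\<close> is the set of elements of size \<open>n\<close>. The operations are total functions on the ambient
  type, but nothing is assumed about their values outside of \<open>\<Union>n. C n\<close>.\<close>

locale catalan_signature =
  fixes C :: "nat \<Rightarrow> 'a set"
    and e :: 'a
    and lam :: "'a \<Rightarrow> 'a"
    and oplus :: "'a \<Rightarrow> 'a \<Rightarrow> 'a"  (infixl \<open>\<oplus>\<close> 65)
begin

definition elements :: "'a set" where
  "elements = (\<Union>n. C n)"

definition indecomposable :: "'a \<Rightarrow> bool" where
  "indecomposable t \<longleftrightarrow> (\<exists>s\<in>elements. t = lam s)"

definition decomposable :: "'a \<Rightarrow> bool" where
  "decomposable t \<longleftrightarrow> (\<exists>u v. indecomposable u \<and> v \<in> elements - C 0 \<and> t = u \<oplus> v)"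

end

locale catalan_structure = catalan_signature C e lam oplus
  for C :: "nat \<Rightarrow> 'a set"
    and e :: 'a
    and lam :: "'a \<Rightarrow> 'a"
    and oplus :: "'a \<Rightarrow> 'a \<Rightarrow> 'a"  (infixl \<open>\<oplus>\<close> 65) +
  assumes disjoint: "m \<noteq> n \<Longrightarrow> C m \<inter> C n = {}"
    and C_0: "C 0 = {e}"
    and lam_closed: "t \<in> C n \<Longrightarrow> lam t \<in> C (n + 1)"
    and oplus_closed: "t \<in> C m \<Longrightarrow> u \<in> C n \<Longrightarrow> t \<oplus> u \<in> C (m + n)"
    and oplus_assoc:
      "t \<in> elements \<Longrightarrow> u \<in> elements \<Longrightarrow> v \<in> elements \<Longrightarrow> (t \<oplus> u) \<oplus> v = t \<oplus> (u \<oplus> v)"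
    and e_oplus: "t \<in> elements \<Longrightarrow> e \<oplus> t = t"
    and oplus_e: "t \<in> elements \<Longrightarrow> t \<oplus> e = t"
    and some_form: "t \<in> elements \<Longrightarrow> t = e \<or> indecomposable t \<or> decomposable t"
    and e_not_indecomposable: "\<not> indecomposable e"
    and e_not_decomposable: "\<not> decomposable e"
    and not_both_forms: "\<not> (indecomposable t \<and> decomposable t)"
    and lam_unique: "s \<in> elements \<Longrightarrow> s' \<in> elements \<Longrightarrow> lam s = lam s' \<Longrightarrow> s = s'"
    and oplus_unique:
      "indecomposable u \<Longrightarrow> v \<in> elements - C 0 \<Longrightarrow>
       indecomposable u' \<Longrightarrow> v' \<in> elements - C 0 \<Longrightarrow>
       u \<oplus> v = u' \<oplus> v' \<Longrightarrow> u = u' \<and> v = v'"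
begin

definition gamma :: "'a \<Rightarrow> 'a" where
  "gamma t = t \<oplus> lam e"

text \<open>Since the structure is not a datatype, \<open>\<ominus>\<close> and \<open>h\<close> are given by the inductively defined graphs
  of their recursion equations. The equations themselves, i.e. the well-definedness of both
  functions, are derived below.\<close>

inductive ominus_graph :: "'a \<Rightarrow> 'a \<Rightarrow> 'a \<Rightarrow> bool" for v where
  graph_e: "ominus_graph v e v"
| graph_lam: "u \<in> elements \<Longrightarrow> ominus_graph v u w \<Longrightarrow> ominus_graph v (lam u) (lam w)"
| graph_oplus: "t \<in> elements \<Longrightarrow> u \<in> elements \<Longrightarrow> t \<noteq> e \<Longrightarrow> u \<noteq> e \<Longrightarrow>
    ominus_graph v u w \<Longrightarrow> ominus_graph v (t \<oplus> u) (t \<oplus> w)"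

definition ominus :: "'a \<Rightarrow> 'a \<Rightarrow> 'a"  (infixl \<open>\<ominus>\<close> 65) where
  "t \<ominus> v = (THE w. ominus_graph v t w)"

inductive h_graph :: "'a \<Rightarrow> 'a \<Rightarrow> bool" where
  h_graph_e: "h_graph e e"
| h_graph_step: "u \<in> elements \<Longrightarrow> v \<in> elements \<Longrightarrow> h_graph u a \<Longrightarrow> h_graph v b \<Longrightarrow>
    h_graph (lam u \<oplus> v) (b \<ominus> gamma a)"

definition h :: "'a \<Rightarrow> 'a" where
  "h t = (THE w. h_graph t w)"

lemma elementsI: "t \<in> C n \<Longrightarrow> t \<in> elements"
  by (auto simp: elements_def)

lemma elementsE: assumes "t \<in> elements" obtains n where "t \<in> C n"
  using assms by (auto simp: elements_def)

lemma e_in [simp]: "e \<in> elements"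
  using C_0 by (auto intro: elementsI)

lemma lam_in [simp]: "t \<in> elements \<Longrightarrow> lam t \<in> elements"
  by (meson elementsE elementsI lam_closed)

lemma oplus_in [simp]: "t \<in> elements \<Longrightarrow> u \<in> elements \<Longrightarrow> t \<oplus> u \<in> elements"
  by (meson elementsE elementsI oplus_closed)

lemma gamma_in [simp]: "t \<in> elements \<Longrightarrow> gamma t \<in> elements"
  by (simp add: gamma_def)

lemma lam_indecomposable: "t \<in> elements \<Longrightarrow> indecomposable (lam t)"
  by (auto simp: indecomposable_def)

lemma size_unique: "t \<in> C m \<Longrightarrow> t \<in> C n \<Longrightarrow> m = n"
  using disjoint by blast

lemma lam_ne_e [simp]: "t \<in> elements \<Longrightarrow> lam t \<noteq> e"
  using e_not_indecomposable lam_indecomposable by metis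

lemma oplus_eq_e: 
  assumes "t \<in> elements" "u \<in> elements" "t \<oplus> u = e" shows "u = e"
proof -
  obtain m n where "t \<in> C m" "u \<in> C n" using assms by (meson elementsE)
  moreover from this have "e \<in> C (m + n)" using assms oplus_closed by metis
  ultimately show ?thesis using C_0 size_unique[of e 0 "m + n"] by auto
qed

lemma lam_oplus_ne_e: "u \<in> elements \<Longrightarrow> v \<in> elements \<Longrightarrow> lam u \<oplus> v \<noteq> e"
  using oplus_eq_e[of "lam u" v] oplus_e[of "lam u"] lam_ne_e[of u] lam_in[of u] by metis

lemma nonempty_form:
  assumes "t \<in> elements" "t \<noteq> e"
  obtains u v where "u \<in> elements" "v \<in> elements" "t = lam u \<oplus> v"
proof (cases "indecomposable t")
  case True
  then obtain u where "u \<in> elements" "t = lam u" by (auto simp: indecomposable_def)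
  then show ?thesis using that[of u e] oplus_e[of t] assms by auto
next
  case False
  then have "decomposable t" using some_form assms by blast
  then show ?thesis using that by (auto simp: decomposable_def indecomposable_def)
qed

lemma nonempty_form_unique:
  assumes "u \<in> elements" "v \<in> elements" "u' \<in> elements" "v' \<in> elements"
    and eq: "lam u \<oplus> v = lam u' \<oplus> v'"
  shows "u = u' \<and> v = v'"
proof -
  have dec: "decomposable (lam x \<oplus> y)" if "x \<in> elements" "y \<in> elements" "y \<noteq> e" for x y
    using that lam_indecomposable C_0 unfolding decomposable_def by blast
  show ?thesis
  proof (cases "v = e \<or> v' = e")
    case True
    have "v = e" if "v' = e"
    proof (rule ccontr)
      assume "v \<noteq> e"
      then have "decomposable (lam u')" using dec[of u v] assms that oplus_e by simp
      then show False using not_both_forms lam_indecomposable assms by blast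
    qed
    moreover have "v' = e" if "v = e"
    proof (rule ccontr)
      assume "v' \<noteq> e"
      then have "decomposable (lam u)" using dec[of u' v'] assms that oplus_e by simp
      then show False using not_both_forms lam_indecomposable assms by blast
    qed
    ultimately have "v = e \<and> v' = e" using True by blast
    then show ?thesis using assms lam_unique[of u u'] by (simp add: oplus_e)
  next
    case False
    then show ?thesis
      using oplus_unique[of "lam u" v "lam u'" v'] assms lam_indecomposable C_0
        lam_unique[of u u'] by simp
  qed
qed

lemma size_induct [consumes 1, case_names e step]:
  assumes "t \<in> elements" "P e"
    and step: "\<And>u v. u \<in> elements \<Longrightarrow> v \<in> elements \<Longrightarrow> P u \<Longrightarrow> P v \<Longrightarrow> P (lam u \<oplus> v)"
  shows "P t"
proof -
  have "\<forall>t\<in>C n. P t" for n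
  proof (induction n rule: less_induct)
    case (less n)
    show ?case
    proof
      fix t assume t: "t \<in> C n"
      show "P t"
      proof (cases "t = e")
        case False
        then obtain u v where uv: "u \<in> elements" "v \<in> elements" "t = lam u \<oplus> v"
          using nonempty_form[OF elementsI[OF t]] by blast
        then obtain i j where ij: "u \<in> C i" "v \<in> C j" by (meson elementsE)
        have "t \<in> C (i + 1 + j)" using uv ij lam_closed oplus_closed by metis
        then have "n = i + 1 + j" using t size_unique by blast
        then have "i < n" "j < n" by auto
        then have "P u" "P v" using less.IH ij by blast+
        then show ?thesis using step uv by simp
      qed (use assms in simp)
    qed
  qed
  then show ?thesis using assms(1) elementsE by metis
qed

lemma ominus_graph_in:
  "ominus_graph v t w \<Longrightarrow> v \<in> elements \<Longrightarrow> t \<in> elements \<and> w \<in> elements"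
  by (induction rule: ominus_graph.induct) auto

lemma ominus_graph_ex:
  assumes "t \<in> elements" "v \<in> elements"
  shows "\<exists>w. ominus_graph v t w"
  using assms(1)
proof (induction t rule: size_induct)
  case e
  then show ?case using graph_e by blast
next
  case (step u y)
  show ?case
  proof (cases "y = e")
    case True
    then show ?thesis using step graph_lam by (auto simp: oplus_e)
  next
    case False
    then show ?thesis using step graph_oplus[of "lam u" y] by auto
  qed
qed

lemma ominus_graph_e: assumes "ominus_graph v e w" shows "w = v"
  using assms
proof (cases rule: ominus_graph.cases)
  case (graph_oplus t u w')
  then show ?thesis using oplus_eq_e[of t u] by auto
next
  case (graph_lam u w')
  then show ?thesis using lam_ne_e[of u] by auto
qed

lemma ominus_graph_lam:
  assumes "ominus_graph v (lam u) w" "u \<in> elements"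
  shows "\<exists>w'. ominus_graph v u w' \<and> w = lam w'"
  using assms(1)
proof (cases rule: ominus_graph.cases)
  case graph_e
  then show ?thesis using assms by auto
next
  case (graph_lam u' w')
  then show ?thesis using assms lam_unique by metis
next
  case (graph_oplus t s w')
  then obtain a b where ab: "a \<in> elements" "b \<in> elements" "t = lam a \<oplus> b"
    using nonempty_form by metis
  then have "lam u \<oplus> e = lam a \<oplus> (b \<oplus> s)"
    using graph_oplus assms by (simp add: oplus_e oplus_assoc)
  then have "b \<oplus> s = e"
    using nonempty_form_unique[of u e a "b \<oplus> s"] ab graph_oplus assms by simp
  then show ?thesis using oplus_eq_e ab graph_oplus by metis
qed

lemma ominus_graph_oplus:
  assumes "ominus_graph v (lam u \<oplus> r) w" "u \<in> elements" "r \<in> elements" "r \<noteq> e" "v \<in> elements"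
  shows "\<exists>w'. ominus_graph v r w' \<and> w = lam u \<oplus> w'"
  using assms(1)
proof (cases rule: ominus_graph.cases)
  case graph_e
  then show ?thesis using assms oplus_eq_e lam_in by metis
next
  case (graph_lam u' w')
  then have "lam u \<oplus> r = lam u' \<oplus> e" by (simp add: oplus_e)
  then show ?thesis
    using nonempty_form_unique[of u r u' e] graph_lam assms by simp
next
  case (graph_oplus t s w')
  then obtain a b where ab: "a \<in> elements" "b \<in> elements" "t = lam a \<oplus> b"
    using nonempty_form by metis
  have w': "w' \<in> elements" using graph_oplus assms ominus_graph_in by blast
  have "lam u \<oplus> r = lam a \<oplus> (b \<oplus> s)"
    using graph_oplus ab by (simp add: oplus_assoc)
  then have eq: "u = a" "r = b \<oplus> s"
    using nonempty_form_unique[of u r a "b \<oplus> s"] ab graph_oplus assms by simp_all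
  have w: "w = lam u \<oplus> (b \<oplus> w')"
    using graph_oplus ab eq w' by (simp add: oplus_assoc)
  have "ominus_graph v r (b \<oplus> w')"
  proof (cases "b = e")
    case True
    then show ?thesis using eq graph_oplus w' by (simp add: e_oplus)
  next
    case False
    then show ?thesis using eq ab graph_oplus ominus_graph.graph_oplus by simp
  qed
  then show ?thesis using w by blast
qed

lemma ominus_graph_unique:
  assumes "t \<in> elements" "v \<in> elements" "ominus_graph v t w1" "ominus_graph v t w2"
  shows "w1 = w2"
  using assms(1,3,4)
proof (induction t arbitrary: w1 w2 rule: size_induct)
  case e
  then show ?case using ominus_graph_e by metis
next
  case (step u y)
  show ?case
  proof (cases "y = e")
    case True
    then have "ominus_graph v (lam u) w1" "ominus_graph v (lam u) w2"
      using step.prems step.hyps by (simp_all add: oplus_e)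
    then show ?thesis using step.IH(1) step.hyps(1) ominus_graph_lam by blast
  next
    case False
    then obtain w1' w2' where "ominus_graph v y w1'" "w1 = lam u \<oplus> w1'"
        "ominus_graph v y w2'" "w2 = lam u \<oplus> w2'"
      using ominus_graph_oplus[OF _ step.hyps _ assms(2)] step.prems by meson
    then show ?thesis using step.IH(2) by blast
  qed
qed

lemma ominus_eqI: "ominus_graph v t w \<Longrightarrow> v \<in> elements \<Longrightarrow> t \<ominus> v = w"
  unfolding ominus_def using ominus_graph_unique ominus_graph_in by blast

lemma ominus_graph_ominus: "t \<in> elements \<Longrightarrow> v \<in> elements \<Longrightarrow> ominus_graph v t (t \<ominus> v)"
  using ominus_graph_ex ominus_eqI by metis

lemma ominus_in [simp]: "t \<in> elements \<Longrightarrow> v \<in> elements \<Longrightarrow> t \<ominus> v \<in> elements"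
  using ominus_graph_ominus ominus_graph_in by blast

lemma e_ominus: "v \<in> elements \<Longrightarrow> e \<ominus> v = v"
  by (intro ominus_eqI graph_e)

lemma lam_ominus: "u \<in> elements \<Longrightarrow> v \<in> elements \<Longrightarrow> lam u \<ominus> v = lam (u \<ominus> v)"
  by (intro ominus_eqI graph_lam ominus_graph_ominus)

lemma oplus_ominus:
  "t \<in> elements \<Longrightarrow> u \<in> elements \<Longrightarrow> v \<in> elements \<Longrightarrow> t \<noteq> e \<Longrightarrow> u \<noteq> e \<Longrightarrow>
   (t \<oplus> u) \<ominus> v = t \<oplus> (u \<ominus> v)"
  by (intro ominus_eqI graph_oplus ominus_graph_ominus)

lemma h_graph_in: "h_graph t w \<Longrightarrow> t \<in> elements \<and> w \<in> elements"
  by (induction rule: h_graph.induct) auto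

lemma h_graph_ex: "t \<in> elements \<Longrightarrow> \<exists>w. h_graph t w"
  by (induction t rule: size_induct) (blast intro: h_graph.intros)+

lemma h_graph_unique:
  assumes "t \<in> elements" "h_graph t w1" "h_graph t w2"
  shows "w1 = w2"
  using assms
proof (induction t arbitrary: w1 w2 rule: size_induct)
  case e
  have "w = e" if "h_graph e w" for w
    using that
  proof cases
    case (h_graph_step u v a b)
    then show ?thesis using lam_oplus_ne_e[of u v] by simp
  qed
  then show ?case using e by blast
next
  case (step u v)
  have *: "\<exists>a b. h_graph u a \<and> h_graph v b \<and> w = b \<ominus> gamma a" if "h_graph (lam u \<oplus> v) w" for w
    using that
  proof cases
    case h_graph_e
    then show ?thesis using step lam_oplus_ne_e[of u v] by simp
  next
    case (h_graph_step u' v' a b)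
    then show ?thesis using nonempty_form_unique[of u v u' v'] step by auto
  qed
  show ?case using *[OF step.prems(1)] *[OF step.prems(2)] step.IH by blast
qed

lemma h_eqI: "h_graph t w \<Longrightarrow> h t = w"
  unfolding h_def using h_graph_unique h_graph_in by blast

lemma h_graph_h: "t \<in> elements \<Longrightarrow> h_graph t (h t)"
  using h_graph_ex h_eqI by metis

lemma h_in [simp]: "t \<in> elements \<Longrightarrow> h t \<in> elements"
  using h_graph_h h_graph_in by blast

lemma h_e: "h e = e"
  by (intro h_eqI h_graph_e)

lemma h_step: "u \<in> elements \<Longrightarrow> v \<in> elements \<Longrightarrow> h (lam u \<oplus> v) = h v \<ominus> gamma (h u)"
  by (intro h_eqI h_graph_step h_graph_h)

end

text \<open>The division is exact.\<close>

definition catalan_number :: "nat \<Rightarrow> nat" where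
  "catalan_number k = (2 * k choose k) div (k + 1)"

end

theory Submission
  imports Defs "HOL-Computational_Algebra.Formal_Power_Series"
begin

text \<open>Reading a nonempty element from the right, it is uniquely \<open>u \<oplus> lam w\<close>, and
  \<open>h (u \<oplus> lam w) = h w \<oplus> lam (h u)\<close>. Hence \<open>h\<close> is a size-preserving involution, and
  \<open>u \<oplus> lam w\<close> is a fixed point iff \<open>w = h u\<close>. The cardinalities of the \<open>C k\<close> satisfy
  Segner's recurrence, so their generating function \<open>c\<close> satisfies \<open>(1 - 2Xc)\<^sup>2 = 1 - 4X\<close>;
  differentiating this equation yields the closed form.\<close>

section \<open>Closed form of a solution of Segner's recurrence\<close>

lemma catalan_two_term_recurrence:
  fixes c :: "nat \<Rightarrow> nat"
  assumes c0: "c 0 = 1" and c_Suc: "\<And>n. c (Suc n) = (\<Sum>i\<le>n. c i * c (n - i))"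
  shows "(n + 2) * c (Suc n) = (4 * n + 2) * c n"
proof -
  define F where "F = Abs_fps (\<lambda>n. of_nat (c n) :: rat)"
  have F_nth: "fps_nth F m = of_nat (c m)" for m
    by (simp add: F_def)
  have F: "F = 1 + fps_X * (F * F)"
  proof (rule fps_ext)
    fix n show "fps_nth F n = fps_nth (1 + fps_X * (F * F)) n"
      by (cases n) (simp_all add: F_nth c0 c_Suc fps_mult_nth[of F F] atLeast0AtMost)
  qed
  define S where "S = 1 - 2 * fps_X * F"
  have "S * S = 1 - 4 * fps_X * (F - fps_X * (F * F))"
    by (simp add: S_def algebra_simps)
  also have "F - fps_X * (F * F) = 1"
    using F by (metis add_diff_cancel_right')
  finally have S2: "S * S = 1 - 4 * fps_X" by simp
  have "2 * (S * fps_deriv S) = fps_deriv (S * S)"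
    by (simp add: algebra_simps)
  also have "\<dots> = -4"
    unfolding S2 by (simp add: fps_numeral_fps_const)
  \<comment> \<open>Multiplying by \<open>S\<close> brings back \<open>S * S\<close>, so
    \<open>S2\<close> turns the equation into a linear one with polynomial coefficients.\<close>
  finally have "2 * (S * (S * fps_deriv S)) = - 4 * S"
    by (metis mult.commute mult.left_commute)
  then have "2 * ((1 - 4 * fps_X) * fps_deriv S) = - 4 * S"
    by (simp add: S2 mult.assoc[symmetric])
  \<comment> \<open>By \<open>S_nth\<close> the coefficients of \<open>S\<close> are shifted by one
    against \<open>c\<close>; so index \<open>Suc n\<close>, after the derivative's own shift,
    relates \<open>c n\<close> to \<open>c (Suc n)\<close>.\<close>
  then have "fps_nth (2 * ((1 - 4 * fps_X) * fps_deriv S)) (Suc n) = fps_nth (- 4 * S) (Suc n)"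
    by simp
  moreover have S_nth: "fps_nth S (Suc m) = - 2 * of_nat (c m)" for m
    by (simp add: S_def F_nth fps_numeral_fps_const mult.assoc)
  ultimately have "of_nat (n + 2) * of_nat (c (Suc n)) = (of_nat (4 * n + 2) * of_nat (c n) :: rat)"
    by (simp add: fps_numeral_fps_const ring_distribs mult.assoc fps_deriv_nth algebra_simps)
  then show ?thesis
    by (metis of_nat_eq_iff of_nat_mult)
qed

lemma catalan_numberI:
  fixes c :: "nat \<Rightarrow> nat"
  assumes c0: "c 0 = 1" and c_Suc: "\<And>n. c (Suc n) = (\<Sum>i\<le>n. c i * c (n - i))"
  shows "c n = catalan_number n"
proof -
  have "(n + 1) * c n = 2 * n choose n"
  proof (induction n)
    case (Suc n)
    \<comment> \<open>Central binomials obey the matching recurrence: absorption twice, with the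
      symmetry of row \<open>2 * n + 1\<close> in between.\<close>
    have "(n + 1) * ((2 * Suc n) choose Suc n) = 2 * ((2 * n + 1) * (2 * n choose n))"
    proof -
      have "(n + 1) * (2 * Suc n choose Suc n) = 2 * (n + 1) * (Suc (2 * n) choose n)"
        using Suc_times_binomial_eq[of "Suc (2 * n)" n] by simp
      also have "Suc (2 * n) choose n = Suc (2 * n) choose Suc n"
        using binomial_symmetric[of n "Suc (2 * n)"] by (simp add: numeral_2_eq_2)
      also have "2 * (n + 1) * (Suc (2 * n) choose Suc n) = 2 * ((2 * n + 1) * (2 * n choose n))"
        using Suc_times_binomial_eq[of "2 * n" n] by (simp add: algebra_simps)
      finally show ?thesis .
    qed
    also have "\<dots> = (n + 1) * ((4 * n + 2) * c n)"
      unfolding Suc.IH[symmetric] by (simp add: algebra_simps)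
    also have "\<dots> = (n + 1) * ((Suc n + 1) * c (Suc n))"
      using catalan_two_term_recurrence[of c n, OF assms] by simp
    finally show ?case by (metis Suc_eq_plus1 mult_cancel1 nat.distinct(1))
  qed (simp add: c0)
  then show ?thesis
    by (metis catalan_number_def nonzero_mult_div_cancel_left Suc_eq_plus1 nat.distinct(1))
qed

section \<open>Decomposition from the right\<close>

context catalan_structure
begin

text \<open>Mirror image of \<open>size_induct\<close>: the last summand is split off. In
  \<open>lam u \<oplus> v\<close> it is the last summand of \<open>v\<close>, or
  \<open>lam u\<close> itself if \<open>v = e\<close>; both pieces are strictly smaller.\<close>

lemma right_induct [consumes 1, case_names e step]:
  assumes "t \<in> elements" "P e"
    and step: "\<And>u w. u \<in> elements \<Longrightarrow> w \<in> elements \<Longrightarrow> P u \<Longrightarrow> P w \<Longrightarrow> P (u \<oplus> lam w)"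
  shows "P t"
proof -
  have right_form: "t = e \<or> (\<exists>u\<in>elements. \<exists>w\<in>elements. t = u \<oplus> lam w)"
    if "t \<in> elements" for t
    using that
  proof (induction t rule: size_induct)
    case (step u v)
    then consider "v = e" | x w where "x \<in> elements" "w \<in> elements" "v = x \<oplus> lam w" by blast
    then show ?case
    proof cases
      case 1
      then show ?thesis using step.hyps by (metis e_in e_oplus lam_in oplus_e)
    next
      case 2
      then have "lam u \<oplus> v = (lam u \<oplus> x) \<oplus> lam w" "lam u \<oplus> x \<in> elements"
        using step.hyps by (simp_all add: oplus_assoc)
      then show ?thesis using 2(2) by blast
    qed
  qed simp
  have "t \<in> C n \<Longrightarrow> P t" for n
  proof (induction n arbitrary: t rule: less_induct)
    case (less n)
    show ?case
    proof (cases "t = e")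
      case False
      then obtain u w where uw: "u \<in> elements" "w \<in> elements" "t = u \<oplus> lam w"
        using right_form less.prems elementsI by blast
      then obtain i j where ij: "u \<in> C i" "w \<in> C j" by (meson elementsE)
      have "n = i + (j + 1)"
        using oplus_closed[OF ij(1) lam_closed[OF ij(2)]] less.prems uw(3) size_unique by blast
      then have "P u" "P w" using less.IH[OF _ ij(1)] less.IH[OF _ ij(2)] by simp_all
      then show ?thesis using step uw by simp
    qed (use assms in simp)
  qed
  then show ?thesis using assms(1) elementsE by metis
qed

lemma oplus_lam_ne_e: "u \<in> elements \<Longrightarrow> w \<in> elements \<Longrightarrow> u \<oplus> lam w \<noteq> e"
  using oplus_eq_e lam_in lam_ne_e by blast

text \<open>Uniqueness from the left strips the summands of \<open>u\<close> and \<open>u'\<close>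
  in parallel; \<open>lam_ne\<close> excludes that one side runs out first.\<close>

lemma right_form_unique:
  assumes "u \<in> elements" "w \<in> elements" "u' \<in> elements" "w' \<in> elements"
    and "u \<oplus> lam w = u' \<oplus> lam w'"
  shows "u = u' \<and> w = w'"
proof -
  have lam_ne: "lam x \<noteq> (lam a \<oplus> b) \<oplus> lam y"
    if "x \<in> elements" "a \<in> elements" "b \<in> elements" "y \<in> elements" for x a b y
    using nonempty_form_unique[of x e a "b \<oplus> lam y"] that oplus_lam_ne_e[of b y]
    by (auto simp: oplus_e oplus_assoc)
  show ?thesis
    using assms(1,3,5)
  proof (induction u arbitrary: u' rule: size_induct)
    case e
    then show ?case
      using assms(2,4) lam_ne lam_unique by (metis e_oplus lam_in nonempty_form)
  next
    case (step a b)
    have "u' \<noteq> e"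
      using step.prems(2) step.hyps assms(2,4) lam_ne[of w' a b w] by (auto simp: e_oplus)
    then obtain a' b' where u': "a' \<in> elements" "b' \<in> elements" "u' = lam a' \<oplus> b'"
      using nonempty_form step.prems(1) by metis
    then have "a = a' \<and> b \<oplus> lam w = b' \<oplus> lam w'"
      using step.prems(2) step.hyps assms(2,4)
        nonempty_form_unique[of a "b \<oplus> lam w" a' "b' \<oplus> lam w'"] by (simp add: oplus_assoc)
    then show ?case using step.IH(2) u' by blast
  qed
qed

section \<open>Action of \<open>h\<close> on the right decomposition\<close>

lemma oplus_lam_ominus:
  assumes "u \<in> elements" "w \<in> elements" "v \<in> elements"
  shows "(u \<oplus> lam w) \<ominus> v = u \<oplus> lam (w \<ominus> v)"
  using assms by (cases "u = e") (simp_all add: e_oplus lam_ominus oplus_ominus)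

text \<open>Induction on the leading summands:
  \<open>h (b \<oplus> lam w) = h w \<oplus> lam (h b)\<close>, and
  \<open>\<ominus> gamma (h a)\<close> acts only inside the last summand, where
  \<open>h b \<ominus> gamma (h a)\<close> is \<open>h (lam a \<oplus> b)\<close>.\<close>

lemma h_oplus_lam:
  assumes "u \<in> elements" "w \<in> elements"
  shows "h (u \<oplus> lam w) = h w \<oplus> lam (h u)"
  using assms(1)
proof (induction u rule: size_induct)
  case e
  show ?case using h_step[of w e] assms(2) by (simp add: e_oplus oplus_e h_e e_ominus gamma_def)
next
  case (step a b)
  then show ?case using assms(2) by (simp add: oplus_assoc h_step oplus_lam_ominus)
qed

text \<open>By \<open>h_oplus_lam\<close>, \<open>h\<close> swaps the two parts and applies itself
  to each; doing so twice restores the order.\<close>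

lemma h_h: "t \<in> elements \<Longrightarrow> h (h t) = t"
  by (induction t rule: right_induct) (simp_all add: h_e h_oplus_lam)

lemma h_closed: assumes "t \<in> C n" shows "h t \<in> C n"
proof -
  \<comment> \<open>\<open>right_induct\<close> does not track sizes, so the size is generalised and
    compared with the sum of the parts' sizes by disjointness.\<close>
  have "\<forall>n. t \<in> C n \<longrightarrow> h t \<in> C n"
    using elementsI[OF assms]
  proof (induction t rule: right_induct)
    case e
    then show ?case by (simp add: h_e)
  next
    case (step u w)
    then obtain i j where ij: "u \<in> C i" "w \<in> C j" by (meson elementsE)
    then have "u \<oplus> lam w \<in> C (i + (j + 1))" "h w \<oplus> lam (h u) \<in> C (j + (i + 1))"
      using step.IH lam_closed oplus_closed by blast+
    then show ?case using step.hyps size_unique by (auto simp: h_oplus_lam ac_simps)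
  qed
  then show ?thesis using assms by blast
qed

section \<open>Fixed points and their sizes\<close>

lemma h_fixed_points: "{t \<in> elements. h t = t} = {e} \<union> {u \<oplus> lam (h u) |u. u \<in> elements}"
proof (intro set_eqI iffI)
  fix t assume "t \<in> {t \<in> elements. h t = t}"
  then have "t \<in> elements" "h t = t" by auto
  then show "t \<in> {e} \<union> {u \<oplus> lam (h u) |u. u \<in> elements}"
  proof (induction t rule: right_induct)
    case (step u w)
    then have "w = h u" using right_form_unique[of "h w" "h u" u w] by (simp add: h_oplus_lam)
    then show ?case using step.hyps by blast
  qed simp
\<comment> \<open>Conversely, \<open>h (u \<oplus> lam (h u)) = h (h u) \<oplus> lam (h u)\<close>,
  and \<open>h (h u) = u\<close>.\<close>
qed (auto simp: h_e h_oplus_lam h_h)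

lemma oplus_lam_h_closed: assumes "u \<in> C k" shows "u \<oplus> lam (h u) \<in> C (2 * k + 1)"
  using oplus_closed[OF assms lam_closed[OF h_closed[OF assms]]] by (simp add: mult_2)

lemma h_fixed_points_odd_size:
  "{t \<in> C (2 * k + 1). h t = t} = (\<lambda>u. u \<oplus> lam (h u)) ` C k"
proof (intro set_eqI iffI)
  fix t assume "t \<in> {t \<in> C (2 * k + 1). h t = t}"
  then have t: "t \<in> C (2 * k + 1)" "t \<in> {t \<in> elements. h t = t}" by (auto intro: elementsI)
  have "t \<noteq> e" using t(1) size_unique[of e "2 * k + 1" 0] C_0 by auto
  then obtain u where u: "u \<in> elements" "t = u \<oplus> lam (h u)" using t(2) h_fixed_points by blast
  then obtain j where j: "u \<in> C j" by (meson elementsE)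
  then have "2 * k + 1 = 2 * j + 1" using t(1) u(2) oplus_lam_h_closed size_unique by blast
  then show "t \<in> (\<lambda>u. u \<oplus> lam (h u)) ` C k" using j u by auto
qed (auto simp: oplus_lam_h_closed[simplified] h_oplus_lam h_h elementsI)

lemma h_fixed_points_even_size:
  assumes "n > 0" "even n"
  shows "{t \<in> C n. h t = t} = {}"
proof -
  have False if t: "t \<in> C n" "h t = t" for t
  proof -
    have "t \<noteq> e" using t(1) size_unique[of e n 0] C_0 assms by auto
    then obtain u where u: "u \<in> elements" "t = u \<oplus> lam (h u)"
      using t h_fixed_points elementsI by blast
    then obtain j where "u \<in> C j" by (meson elementsE)
    then have "n = 2 * j + 1" using t(1) u(2) oplus_lam_h_closed size_unique by blast
    then show False using assms by simp
  qed
  then show ?thesis by blast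
qed

lemma card_h_fixed_points_odd_size: "card {t \<in> C (2 * k + 1). h t = t} = card (C k)"
  unfolding h_fixed_points_odd_size
proof (intro card_image inj_onI)
  fix u u' assume "u \<in> C k" "u' \<in> C k" "u \<oplus> lam (h u) = u' \<oplus> lam (h u')"
  then show "u = u'" using right_form_unique[of u "h u" u' "h u'"] by (simp add: elementsI)
qed

text \<open>Segner's recurrence as a bijection. The index \<open>i\<close> is the size of
  \<open>u\<close>, so disjointness recovers it in the injectivity proof.\<close>

lemma bij_betw_C_Suc:
  "bij_betw (\<lambda>(i, u, v). lam u \<oplus> v) (SIGMA i:{..n}. C i \<times> C (n - i)) (C (Suc n))"
  unfolding bij_betw_def
proof (intro conjI inj_onI set_eqI iffI)
  fix x y
  assume xy: "x \<in> (SIGMA i:{..n}. C i \<times> C (n - i))" "y \<in> (SIGMA i:{..n}. C i \<times> C (n - i))"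
    and eq: "(\<lambda>(i, u, v). lam u \<oplus> v) x = (\<lambda>(i, u, v). lam u \<oplus> v) y"
  obtain i u v j u' v' where [simp]: "x = (i, u, v)" "y = (j, u', v')" by (metis prod_cases3)
  have "u = u' \<and> v = v'"
    using xy eq nonempty_form_unique[of u v u' v'] by (auto intro: elementsI)
  then show "x = y" using xy size_unique[of u i j] by auto
next
  fix t assume "t \<in> (\<lambda>(i, u, v). lam u \<oplus> v) ` (SIGMA i:{..n}. C i \<times> C (n - i))"
  then obtain i u v where "i \<le> n" "u \<in> C i" "v \<in> C (n - i)" "t = lam u \<oplus> v" by auto
  then show "t \<in> C (Suc n)" using oplus_closed[OF lam_closed, of u i v "n - i"] by simp
next
  fix t assume t: "t \<in> C (Suc n)"
  then have "t \<noteq> e" using size_unique[of e "Suc n" 0] C_0 by auto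
  then obtain u v where uv: "u \<in> elements" "v \<in> elements" "t = lam u \<oplus> v"
    using nonempty_form elementsI[OF t] by metis
  then obtain i j where ij: "u \<in> C i" "v \<in> C j" by (meson elementsE)
  then have "Suc n = i + 1 + j" using t uv lam_closed oplus_closed size_unique by metis
  then have "(i, u, v) \<in> (SIGMA i:{..n}. C i \<times> C (n - i))" using ij by auto
  then show "t \<in> (\<lambda>(i, u, v). lam u \<oplus> v) ` (SIGMA i:{..n}. C i \<times> C (n - i))"
    using uv by force
qed

text \<open>Makes \<open>card\<close> meaningful: on infinite sets it would be 0, and the product
  and sum rules for cardinalities could fail.\<close>

lemma finite_C: "finite (C n)"
proof (induction n rule: less_induct)
  case (less n)
  show ?case
  proof (cases n)
    case (Suc m)
    then have "finite (SIGMA i:{..m}. C i \<times> C (m - i))"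
      using less by (intro finite_SigmaI finite_cartesian_product) auto
    then show ?thesis using bij_betw_finite[OF bij_betw_C_Suc, of m] Suc by simp
  qed (simp add: C_0)
qed

lemma card_C: "card (C k) = catalan_number k"
proof (rule catalan_numberI)
  show "card (C (Suc n)) = (\<Sum>i\<le>n. card (C i) * card (C (n - i)))" for n
    using bij_betw_same_card[OF bij_betw_C_Suc, of n] finite_C
    by (simp add: card_SigmaI card_cartesian_product)
qed (simp add: C_0)

end

theorem proposition2p11:
  fixes C :: "nat \<Rightarrow> 'a set"
    and e :: 'a
    and lam :: "'a \<Rightarrow> 'a"
    and oplus :: "'a \<Rightarrow> 'a \<Rightarrow> 'a"  (infixl \<open>\<oplus>\<close> 65)
  assumes "catalan_structure C e lam oplus"
  shows "{t \<in> (\<Union>n. C n). catalan_structure.h C e lam oplus t = t} =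
           {e} \<union> {u \<oplus> lam (catalan_structure.h C e lam oplus u) |u. u \<in> (\<Union>n. C n)}
       \<and> (\<forall>k. card {t \<in> C (2 * k + 1). catalan_structure.h C e lam oplus t = t} = card (C k)
            \<and> card (C k) = catalan_number k)
       \<and> (\<forall>n. n > 0 \<and> even n \<longrightarrow> {t \<in> C n. catalan_structure.h C e lam oplus t = t} = {})"
proof -
  interpret catalan_structure C e lam oplus by fact
  show ?thesis
    by (intro conjI allI impI)
      (simp_all only: h_fixed_points[unfolded elements_def] card_h_fixed_points_odd_size card_C
        h_fixed_points_even_size)
qed

end
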